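(* Let $\kappa$ be a regular uncountable cardinal and let $U,W$ be uniform ultrafilters on $\kappa$ with $U\le_{RB}W$. Then $\pi\mathfrak t(W)\le\pi\mathfrak t(U)$ and $\pi\mathfrak{ch}(U)\le\pi\mathfrak{ch}(W)$.
   Context: $A\subseteq^*B$ means $A\setminus\alpha\subseteq B$ for some $\alpha<\kappa$. A function $f:\kappa\to\kappa$ is almost one-to-one modulo $W$ if there is $X\in W$ such that $f^{-1}[\{\gamma\}]\cap X$ is bounded in $\kappa$ for every $\gamma<\kappa$. $U\le_{RB}W$ (Rudin–Blass) means there is $f:\kappa\to\kappa$ almost one-to-one modulo $W$ with $f_*(W)=U$, where $f_*(W)=\{A\subseteq\kappa: f^{-1}[A]\in W\}$. A $\pi$-base for $U$ is a family $\mathcal B\subseteq[\kappa]^\kappa$ such that every $A\in U$ has some $B\in\mathcal B$ with $B\subseteq^*A$; $\pi\mathfrak{ch}(U)$ is the least size of a $\pi$-base. $\pi\mathfrak t(U)$ is the least regular cardinal $\lambda$ for which there is a $\subseteq^*$-decreasing sequence $\langle X_i:i<\lambda\rangle\subseteq U$ having no pseudo-intersection, i.e. no $Y\in[\kappa]^\kappa$ with $Y\subseteq^*X_i$ for all $i$. *)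

theory Defs
  imports "HOL-Library.FuncSet"
begin

unbundle cardinal_syntax

text \<open>A cardinal \<open>\<kappa>\<close> is a well-order satisfying \<open>Card_order\<close>, and the set \<open>\<kappa>\<close> of
  ordinals below it is \<open>Field \<kappa>\<close>; an ordinal \<open>\<alpha> < \<kappa>\<close>, as a set of ordinals, is
  \<open>underS \<kappa> \<alpha>\<close>. Cardinals live in different types and are compared by \<open>\<le>o\<close>.

  Regular cardinals are infinite by convention; \<open>regularCard\<close> holds vacuously for nonempty
  finite well-orders, so infinity has to be required separately.\<close>

definition regular_cardinal :: "'a rel \<Rightarrow> bool" where
  "regular_cardinal \<kappa> \<longleftrightarrow> Card_order \<kappa> \<and> infinite (Field \<kappa>) \<and> regularCard \<kappa>"

definition regular_uncountable_cardinal :: "'a rel \<Rightarrow> bool" where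
  "regular_uncountable_cardinal \<kappa> \<longleftrightarrow> regular_cardinal \<kappa> \<and> natLeq <o \<kappa>"

definition bounded_in :: "'a rel \<Rightarrow> 'a set \<Rightarrow> bool" where
  "bounded_in \<kappa> A \<longleftrightarrow> (\<exists>\<alpha> \<in> Field \<kappa>. A \<subseteq> underS \<kappa> \<alpha>)"

definition almost_subset :: "'a rel \<Rightarrow> 'a set \<Rightarrow> 'a set \<Rightarrow> bool" where
  "almost_subset \<kappa> A B \<longleftrightarrow> (\<exists>\<alpha> \<in> Field \<kappa>. A - underS \<kappa> \<alpha> \<subseteq> B)"

definition full_size_subsets :: "'a rel \<Rightarrow> 'a set set" where
  "full_size_subsets \<kappa> = {A. A \<subseteq> Field \<kappa> \<and> |A| =o \<kappa>}"


subsection \<open>Ultrafilters on a set\<close>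

text \<open>A filter on the set \<open>S\<close> is a filter of the ambient type that is concentrated on \<open>S\<close>;
  as a family of subsets of \<open>S\<close> it is \<open>sets_of S U\<close>.\<close>

definition sets_of :: "'a set \<Rightarrow> 'a filter \<Rightarrow> 'a set set" where
  "sets_of S U = {A. A \<subseteq> S \<and> (\<forall>\<^sub>F x in U. x \<in> A)}"

definition ultrafilter_on :: "'a set \<Rightarrow> 'a filter \<Rightarrow> bool" where
  "ultrafilter_on S U \<longleftrightarrow>
     U \<le> principal S \<and> U \<noteq> bot \<and> (\<forall>A. A \<subseteq> S \<longrightarrow> A \<in> sets_of S U \<or> S - A \<in> sets_of S U)"

definition uniform_ultrafilter :: "'a rel \<Rightarrow> 'a filter \<Rightarrow> bool" where
  "uniform_ultrafilter \<kappa> U \<longleftrightarrow>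
     ultrafilter_on (Field \<kappa>) U \<and> (\<forall>A \<in> sets_of (Field \<kappa>) U. |A| =o \<kappa>)"


subsection \<open>The Rudin--Blass order\<close>

definition almost_one_to_one :: "'a rel \<Rightarrow> 'a filter \<Rightarrow> ('a \<Rightarrow> 'a) \<Rightarrow> bool" where
  "almost_one_to_one \<kappa> W f \<longleftrightarrow>
     (\<exists>X \<in> sets_of (Field \<kappa>) W. \<forall>\<gamma> \<in> Field \<kappa>. bounded_in \<kappa> (f -` {\<gamma>} \<inter> X))"

definition RB_le :: "'a rel \<Rightarrow> 'a filter \<Rightarrow> 'a filter \<Rightarrow> bool" where
  "RB_le \<kappa> U W \<longleftrightarrow>
     (\<exists>f \<in> Field \<kappa> \<rightarrow> Field \<kappa>. almost_one_to_one \<kappa> W f \<and> filtermap f W = U)"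

lemma sets_of_filtermap:
  assumes "W \<le> principal S" "f \<in> S \<rightarrow> S"
  shows "sets_of S (filtermap f W) = {A. A \<subseteq> S \<and> f -` A \<inter> S \<in> sets_of S W}"
proof -
  have "\<forall>\<^sub>F x in W. x \<in> S"
    using assms(1) by (simp add: le_principal)
  then have "(\<forall>\<^sub>F x in W. f x \<in> A) \<longleftrightarrow> (\<forall>\<^sub>F x in W. f x \<in> A \<and> x \<in> S)" for A
    by (simp add: eventually_conj_iff)
  then show ?thesis
    by (simp add: sets_of_def eventually_filtermap)
qed


subsection \<open>The \<open>\<pi>\<close>-character\<close>

definition pi_base :: "'a rel \<Rightarrow> 'a filter \<Rightarrow> 'a set set \<Rightarrow> bool" where
  "pi_base \<kappa> U \<B> \<longleftrightarrow>
     \<B> \<subseteq> full_size_subsets \<kappa> \<and> (\<forall>A \<in> sets_of (Field \<kappa>) U. \<exists>B \<in> \<B>. almost_subset \<kappa> B A)"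

definition pi_ch :: "'a rel \<Rightarrow> 'a filter \<Rightarrow> 'a set rel" where
  "pi_ch \<kappa> U = |SOME \<B>. pi_base \<kappa> U \<B> \<and> (\<forall>\<B>'. pi_base \<kappa> U \<B>' \<longrightarrow> |\<B>| \<le>o |\<B>'| )|"

lemma Field_nonempty_of_regular:
  "regular_cardinal \<kappa> \<Longrightarrow> Field \<kappa> \<noteq> {}"
  by (auto simp: regular_cardinal_def)

lemma pi_ch_least:
  assumes "regular_cardinal \<kappa>" "uniform_ultrafilter \<kappa> U"
  shows "\<exists>\<B>. pi_base \<kappa> U \<B> \<and> pi_ch \<kappa> U = |\<B>|"
    and "pi_base \<kappa> U \<B>' \<Longrightarrow> pi_ch \<kappa> U \<le>o |\<B>'|"
proof -
  have "pi_base \<kappa> U (sets_of (Field \<kappa>) U)"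
    unfolding pi_base_def
  proof (intro conjI ballI)
    show "sets_of (Field \<kappa>) U \<subseteq> full_size_subsets \<kappa>"
      using assms(2) by (auto simp: uniform_ultrafilter_def full_size_subsets_def sets_of_def)
    show "\<exists>B \<in> sets_of (Field \<kappa>) U. almost_subset \<kappa> B A"
      if "A \<in> sets_of (Field \<kappa>) U" for A
      using that Field_nonempty_of_regular[OF assms(1)]
      by (intro bexI[of _ A]) (auto simp: almost_subset_def)
  qed
  then have "\<exists>r \<in> {|\<B>| |\<B>. pi_base \<kappa> U \<B>}. \<forall>r' \<in> {|\<B>| |\<B>. pi_base \<kappa> U \<B>}. r \<le>o r'"
    by (intro exists_minim_Card_order) (auto simp: card_of_Card_order)
  then have "\<exists>\<B>. pi_base \<kappa> U \<B> \<and> (\<forall>\<B>'. pi_base \<kappa> U \<B>' \<longrightarrow> |\<B>| \<le>o |\<B>'| )"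
    by auto
  from someI_ex[OF this]
  show "\<exists>\<B>. pi_base \<kappa> U \<B> \<and> pi_ch \<kappa> U = |\<B>|"
    and "pi_base \<kappa> U \<B>' \<Longrightarrow> pi_ch \<kappa> U \<le>o |\<B>'|"
    unfolding pi_ch_def by auto
qed


subsection \<open>The \<open>\<pi>\<close>-tower number\<close>

definition pseudo_intersection :: "'a rel \<Rightarrow> 'b set \<Rightarrow> ('b \<Rightarrow> 'a set) \<Rightarrow> 'a set \<Rightarrow> bool" where
  "pseudo_intersection \<kappa> I X Y \<longleftrightarrow>
     Y \<in> full_size_subsets \<kappa> \<and> (\<forall>i \<in> I. almost_subset \<kappa> Y (X i))"

text \<open>There is a tower of regular length \<open>l\<close> in \<open>U\<close> without pseudo-intersection.\<close>

definition pi_tower_length :: "'a rel \<Rightarrow> 'a filter \<Rightarrow> 'b rel \<Rightarrow> bool" where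
  "pi_tower_length \<kappa> U l \<longleftrightarrow> regular_cardinal l \<and>
     (\<exists>X. (\<forall>i \<in> Field l. X i \<in> sets_of (Field \<kappa>) U) \<and>
          (\<forall>i j. (i, j) \<in> l \<and> i \<noteq> j \<longrightarrow> almost_subset \<kappa> (X j) (X i)) \<and>
          \<not> (\<exists>Y. pseudo_intersection \<kappa> (Field l) X Y))"

text \<open>The least length of such a tower; \<open>None\<close> stands for \<open>\<infinity>\<close> (there is no such tower). Lengths
  are represented on the type \<open>'a set\<close>, which loses nothing: a regular length is at most
  \<open>2\<^sup>\<kappa>\<close>, see \<open>pi_tower_length_representable\<close> below.\<close>

definition pi_t :: "'a rel \<Rightarrow> 'a filter \<Rightarrow> 'a set rel option" where
  "pi_t \<kappa> U =
     (if \<exists>l :: 'a set rel. pi_tower_length \<kappa> U l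
      then Some (SOME l. pi_tower_length \<kappa> U l \<and>
                         (\<forall>l' :: 'a set rel. pi_tower_length \<kappa> U l' \<longrightarrow> l \<le>o l'))
      else None)"

fun card_le_infty :: "'b rel option \<Rightarrow> 'c rel option \<Rightarrow> bool" (infix "\<le>o\<infinity>" 50) where
  "r \<le>o\<infinity> None \<longleftrightarrow> True"
| "None \<le>o\<infinity> Some s \<longleftrightarrow> False"
| "Some r \<le>o\<infinity> Some s \<longleftrightarrow> r \<le>o s"

lemma almost_subset_trans:
  assumes "regular_cardinal \<kappa>" "almost_subset \<kappa> A B" "almost_subset \<kappa> B C"
  shows "almost_subset \<kappa> A C"
proof -
  obtain a b where ab: "a \<in> Field \<kappa>" "b \<in> Field \<kappa>"
    "A - underS \<kappa> a \<subseteq> B" "B - underS \<kappa> b \<subseteq> C"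
    using assms by (auto simp: almost_subset_def)
  have wo: "Well_order \<kappa>"
    using assms(1) by (simp add: regular_cardinal_def card_order_on_def)
  then have "Total \<kappa>" "trans \<kappa>" "antisym \<kappa>" "Refl \<kappa>"
    by (auto simp: order_on_defs)
  then have "(a, b) \<in> \<kappa> \<or> (b, a) \<in> \<kappa>"
    using ab by (metis refl_onD total_on_def)
  then show ?thesis
  proof
    assume "(a, b) \<in> \<kappa>"
    then have "underS \<kappa> a \<subseteq> underS \<kappa> b"
      by (rule underS_incr[OF \<open>trans \<kappa>\<close> \<open>antisym \<kappa>\<close>])
    then show ?thesis
      using ab unfolding almost_subset_def by blast
  next
    assume "(b, a) \<in> \<kappa>"
    then have "underS \<kappa> b \<subseteq> underS \<kappa> a"
      by (rule underS_incr[OF \<open>trans \<kappa>\<close> \<open>antisym \<kappa>\<close>])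
    then show ?thesis
      using ab unfolding almost_subset_def by blast
  qed
qed

lemma pi_tower_length_le:
  fixes l :: "'b rel"
  assumes \<kappa>: "regular_cardinal \<kappa>" and U: "uniform_ultrafilter \<kappa> U"
    and l: "pi_tower_length \<kappa> U l"
  shows "l \<le>o |Pow (Field \<kappa>)|"
proof (rule ccontr)
  assume "\<not> l \<le>o |Pow (Field \<kappa>)|"
  obtain X where X: "\<forall>i \<in> Field l. X i \<in> sets_of (Field \<kappa>) U"
    and dec: "\<forall>i j. (i, j) \<in> l \<and> i \<noteq> j \<longrightarrow> almost_subset \<kappa> (X j) (X i)"
    and no: "\<not> (\<exists>Y. pseudo_intersection \<kappa> (Field l) X Y)"
    and reg: "regular_cardinal l"
    using l unfolding pi_tower_length_def by blast
  have lc: "Card_order l" "Cinfinite l" "regularCard l" "Well_order l"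
    using reg by (auto simp: regular_cardinal_def cinfinite_def card_order_on_def)
  have small: "|Pow (Field \<kappa>)| <o l"
    using \<open>\<not> l \<le>o _\<close> lc by (simp add: not_ordLeq_iff_ordLess card_of_Well_order)
  define F where "F A = {i \<in> Field l. X i = A}" for A
  have cover: "Field l = (\<Union>A \<in> Pow (Field \<kappa>). F A)"
    using X by (auto simp: F_def sets_of_def)
  have "\<exists>A \<in> Pow (Field \<kappa>). \<not> |F A| <o l"
  proof (rule ccontr)
    assume "\<not> ?thesis"
    then have "|\<Union>A \<in> Pow (Field \<kappa>). F A| <o l"
      using lc small by (intro card_of_UNION_ordLess_infinite_Field_regularCard) auto
    then show False
      using card_of_Field_ordIso[OF lc(1)] not_ordLess_ordIso by (metis cover)
  qed
  then obtain A where A: "A \<in> Pow (Field \<kappa>)" "\<not> |F A| <o l" by blast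
  have Fne: "F A \<noteq> {}"
  proof
    assume "F A = {}"
    then have "|F A| <o l"
      using lc(2) by (metis Cinfinite_gt_empty)
    then show False using A by blast
  qed
  have AU: "A \<in> sets_of (Field \<kappa>) U"
    using Fne X by (auto simp: F_def)
  have "almost_subset \<kappa> A (X j)" if j: "j \<in> Field l" for j
  proof -
    have "\<exists>i \<in> F A. (j, i) \<in> l"
    proof (rule ccontr)
      assume no_i: "\<not> ?thesis"
      have "F A \<subseteq> underS l j"
      proof
        fix i assume i: "i \<in> F A"
        then have "i \<in> Field l" by (simp add: F_def)
        moreover have "Total l" "Refl l" using lc(4) by (auto simp: order_on_defs)
        ultimately show "i \<in> underS l j"
          using no_i i j unfolding underS_def by (metis (mono_tags, lifting) mem_Collect_eq refl_onD total_on_def)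
      qed
      then have "|F A| \<le>o |underS l j|" by (rule card_of_mono1)
      moreover have "|underS l j| <o l" using card_of_underS[OF lc(1) j] .
      ultimately show False using A(2) ordLeq_ordLess_trans by blast
    qed
    then obtain i where i: "i \<in> Field l" "X i = A" "(j, i) \<in> l"
      by (auto simp: F_def)
    show ?thesis
    proof (cases "j = i")
      case True
      with i show ?thesis
        using Field_nonempty_of_regular[OF \<kappa>] by (auto simp: almost_subset_def)
    next
      case False
      with i dec show ?thesis by blast
    qed
  qed
  moreover have "A \<in> full_size_subsets \<kappa>"
    using AU A U by (auto simp: full_size_subsets_def uniform_ultrafilter_def)
  ultimately show False
    using no by (auto simp: pseudo_intersection_def)
qed

lemma pi_tower_length_ordIso:
  fixes l :: "'b rel" and l' :: "'c rel"
  assumes l: "pi_tower_length \<kappa> U l" and iso: "l' =o l"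
  shows "pi_tower_length \<kappa> U l'"
proof -
  obtain X where X: "\<forall>i \<in> Field l. X i \<in> sets_of (Field \<kappa>) U"
    and dec: "\<forall>i j. (i, j) \<in> l \<and> i \<noteq> j \<longrightarrow> almost_subset \<kappa> (X j) (X i)"
    and no: "\<not> (\<exists>Y. pseudo_intersection \<kappa> (Field l) X Y)"
    and reg: "regular_cardinal l"
    using l unfolding pi_tower_length_def by blast
  have lc: "Cinfinite l" "regularCard l"
    using reg by (auto simp: regular_cardinal_def cinfinite_def)
  have "Cinfinite l'" "regularCard l'"
    using lc iso Cinfinite_cong regularCard_ordIso ordIso_symmetric by blast+
  then have reg': "regular_cardinal l'"
    by (auto simp: regular_cardinal_def cinfinite_def)
  obtain h where h: "iso l' l h"
    using iso by (auto simp: ordIso_def)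
  have bij: "bij_betw h (Field l') (Field l)"
    using h by (simp add: iso_def)
  have wo: "Well_order l'" "Well_order l"
    using reg reg' by (auto simp: regular_cardinal_def card_order_on_def)
  have mono: "(h i, h j) \<in> l \<and> h i \<noteq> h j" if "(i, j) \<in> l'" "i \<noteq> j" for i j
  proof -
    have "i \<in> Field l'" "j \<in> Field l'" using that by (auto simp: Field_def)
    then show ?thesis
      using that bij h iso_iff2[of l' l h] by (auto simp: bij_betw_def inj_on_def)
  qed
  have im: "h ` Field l' = Field l" using bij by (simp add: bij_betw_def)
  have "\<forall>i \<in> Field l'. (X \<circ> h) i \<in> sets_of (Field \<kappa>) U"
    using X im by auto
  moreover have "\<forall>i j. (i, j) \<in> l' \<and> i \<noteq> j \<longrightarrow> almost_subset \<kappa> ((X \<circ> h) j) ((X \<circ> h) i)"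
    using dec mono by simp
  moreover have "\<not> (\<exists>Y. pseudo_intersection \<kappa> (Field l') (X \<circ> h) Y)"
    using no im[symmetric] by (simp add: pseudo_intersection_def)
  ultimately show ?thesis
    using reg' unfolding pi_tower_length_def by blast
qed

lemma pi_tower_length_representable:
  fixes l :: "'b rel" and \<kappa> :: "'a rel"
  assumes "regular_cardinal \<kappa>" "uniform_ultrafilter \<kappa> U" "pi_tower_length \<kappa> U l"
  shows "\<exists>l' :: 'a set rel. l' =o l \<and> pi_tower_length \<kappa> U l'"
proof -
  have lc: "Card_order l"
    using assms(3) by (simp add: pi_tower_length_def regular_cardinal_def)
  have "|Field l| \<le>o |Pow (Field \<kappa>)|"
    using pi_tower_length_le[OF assms] card_of_Field_ordIso[OF lc] ordIso_ordLeq_trans by blast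
  then obtain g where g: "inj_on g (Field l)" "g ` Field l \<subseteq> Pow (Field \<kappa>)"
    using card_of_ordLeq[of "Field l" "Pow (Field \<kappa>)"] by blast
  have "|g ` Field l| =o |Field l|"
    using g(1) card_of_ordIsoI ordIso_symmetric inj_on_imp_bij_betw by metis
  then have "|g ` Field l| =o l"
    using card_of_Field_ordIso[OF lc] ordIso_transitive by blast
  then show ?thesis
    using pi_tower_length_ordIso[OF assms(3)] by blast
qed

lemma pi_t_eq_None_iff:
  fixes \<kappa> :: "'a rel"
  shows "pi_t \<kappa> U = None \<longleftrightarrow> \<not> (\<exists>l :: 'a set rel. pi_tower_length \<kappa> U l)"
  by (simp add: pi_t_def)

lemma pi_t_least:
  fixes \<kappa> :: "'a rel" and l' :: "'b rel"
  assumes "regular_cardinal \<kappa>" "uniform_ultrafilter \<kappa> U" "pi_tower_length \<kappa> U l'"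
  shows "\<exists>l. pi_t \<kappa> U = Some l \<and> pi_tower_length \<kappa> U l \<and> l \<le>o l'"
proof -
  obtain m :: "'a set rel" where m: "m =o l'" "pi_tower_length \<kappa> U m"
    using pi_tower_length_representable[OF assms] by blast
  let ?R = "{l :: 'a set rel. pi_tower_length \<kappa> U l}"
  have "\<exists>l \<in> ?R. \<forall>l' \<in> ?R. l \<le>o l'"
  proof (rule exists_minim_Card_order)
    show "?R \<noteq> {}" using m(2) by blast
    show "\<forall>l \<in> ?R. Card_order l" by (simp add: pi_tower_length_def regular_cardinal_def)
  qed
  then have "\<exists>l :: 'a set rel. pi_tower_length \<kappa> U l \<and>
      (\<forall>l' :: 'a set rel. pi_tower_length \<kappa> U l' \<longrightarrow> l \<le>o l')"
    by blast
  from someI_ex[OF this] m show ?thesis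
    unfolding pi_t_def using ordLeq_ordIso_trans by auto
qed

end

theory Submission
  imports Defs
begin

text \<open>Since \<open>\<kappa>\<close> is regular, bounded means of size less than \<open>\<kappa>\<close>. If \<open>f\<close> has bounded
  fibres on \<open>X \<in> W\<close>, then both \<open>S \<mapsto> f[S \<inter> X]\<close> and \<open>S \<mapsto> f\<^sup>-\<^sup>1[S] \<inter> X\<close> preserve smallness.
  Hence \<open>B \<mapsto> f[B \<inter> X]\<close> carries a \<open>\<pi>\<close>-base of \<open>W\<close>, restricted to those \<open>B \<subseteq>\<^sup>* X\<close>, to one of
  \<open>f\<^sub>*(W)\<close>, and \<open>A \<mapsto> f\<^sup>-\<^sup>1[A] \<inter> X\<close> lifts a tower in \<open>f\<^sub>*(W)\<close> to one in \<open>W\<close> of the same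
  length; a pseudo-intersection \<open>Y\<close> of the lift would give \<open>f[Y \<inter> X]\<close> below.\<close>

text \<open>Proper initial segments of a cardinal are smaller than it; conversely, regularity makes
  every cofinal set have size \<kappa>, so a smaller set is not cofinal.\<close>

lemma bounded_in_iff_small:
  assumes \<kappa>: "regular_cardinal \<kappa>" and A: "A \<subseteq> Field \<kappa>"
  shows "bounded_in \<kappa> A \<longleftrightarrow> |A| <o \<kappa>"
proof
  have co: "Card_order \<kappa>" and inf: "infinite (Field \<kappa>)" and reg: "regularCard \<kappa>"
    using \<kappa> by (auto simp: regular_cardinal_def)
  show "|A| <o \<kappa>" if "bounded_in \<kappa> A"
    using that card_of_mono1 card_of_underS[OF co] ordLeq_ordLess_trans
    unfolding bounded_in_def by metis
  assume "|A| <o \<kappa>"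
  then have "\<not> cofinal A \<kappa>"
    using reg A not_ordLess_ordIso unfolding regularCard_def by blast
  then obtain a where a: "a \<in> Field \<kappa>" "\<And>b. b \<in> A \<Longrightarrow> a = b \<or> (a, b) \<notin> \<kappa>"
    unfolding cofinal_def by blast
  \<comment> \<open>Failure of \<open>cofinal\<close> only gives an \<open>a\<close> with every
    element of \<open>A\<close> below or equal to it. The strict bound that \<open>underS\<close>
    demands is a point above \<open>a\<close>, which exists because an infinite cardinal has no last
    element.\<close>
  obtain b where b: "b \<in> Field \<kappa>" "a \<noteq> b" "(a, b) \<in> \<kappa>"
    using infinite_Card_order_limit[OF co inf a(1)] by blast
  have "Total \<kappa>" "trans \<kappa>" "antisym \<kappa>" "Refl \<kappa>"
    using co by (auto simp: card_order_on_def order_on_defs)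
  have "c \<in> underS \<kappa> b" if "c \<in> A" for c
  proof -
    have "(c, a) \<in> \<kappa>"
      using a that A \<open>Total \<kappa>\<close> \<open>Refl \<kappa>\<close> by (metis refl_onD subsetD total_on_def)
    then show ?thesis
      using b \<open>trans \<kappa>\<close> \<open>antisym \<kappa>\<close> unfolding underS_def
      by (auto dest: transD antisymD)
  qed
  then show "bounded_in \<kappa> A"
    using b(1) by (auto simp: bounded_in_def)
qed

text \<open>Turns inclusion modulo a bounded set into a cardinality condition, so that images and
  preimages can be treated by counting.\<close>

lemma almost_subset_iff_small:
  assumes "regular_cardinal \<kappa>" "A \<subseteq> Field \<kappa>"
  shows "almost_subset \<kappa> A B \<longleftrightarrow> |A - B| <o \<kappa>"
proof -
  have "almost_subset \<kappa> A B \<longleftrightarrow> bounded_in \<kappa> (A - B)"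
    by (auto simp: almost_subset_def bounded_in_def)
  with assms show ?thesis
    by (metis bounded_in_iff_small Diff_subset order_trans)
qed

lemma small_Un:
  assumes "regular_cardinal \<kappa>" "|A| <o \<kappa>" "|B| <o \<kappa>"
  shows "|A \<union> B| <o \<kappa>"
  using assms card_of_Un_ordLess_infinite_Field by (auto simp: regular_cardinal_def)

lemma full_size_iff_not_small:
  assumes "regular_cardinal \<kappa>"
  shows "A \<in> full_size_subsets \<kappa> \<longleftrightarrow> A \<subseteq> Field \<kappa> \<and> \<not> |A| <o \<kappa>"
proof -
  have co: "Card_order \<kappa>"
    using assms by (simp add: regular_cardinal_def)
  have "|A| \<le>o \<kappa>" if "A \<subseteq> Field \<kappa>"
    using card_of_mono1[OF that] card_of_Field_ordIso[OF co] ordLeq_ordIso_trans by blast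
  then show ?thesis
    using not_ordLess_ordIso ordLeq_iff_ordLess_or_ordIso
    by (auto simp: full_size_subsets_def)
qed

text \<open>The preimage within \<open>X\<close> is a union of fewer than \<kappa> fibres, each
  bounded and hence small; regularity of \<kappa> keeps the union small.\<close>

lemma small_vimage:
  assumes \<kappa>: "regular_cardinal \<kappa>" and X: "X \<subseteq> Field \<kappa>"
    and fib: "\<And>\<gamma>. \<gamma> \<in> Field \<kappa> \<Longrightarrow> bounded_in \<kappa> (f -` {\<gamma>} \<inter> X)"
    and S: "S \<subseteq> Field \<kappa>" "|S| <o \<kappa>"
  shows "|f -` S \<inter> X| <o \<kappa>"
proof -
  have "|f -` {\<gamma>} \<inter> X| <o \<kappa>" if "\<gamma> \<in> S" for \<gamma>
    using that S fib X bounded_in_iff_small[OF \<kappa>, of "f -` {\<gamma>} \<inter> X"] by blast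
  then have "|\<Union>\<gamma> \<in> S. f -` {\<gamma>} \<inter> X| <o \<kappa>"
    using \<kappa> S(2)
    by (intro card_of_UNION_ordLess_infinite_Field_regularCard)
      (auto simp: regular_cardinal_def cinfinite_def)
  moreover have "(\<Union>\<gamma> \<in> S. f -` {\<gamma>} \<inter> X) = f -` S \<inter> X"
    by auto
  ultimately show ?thesis by simp
qed

text \<open>If the image were small, so would be its preimage within \<open>X\<close>. This preimage
  together with the small set \<open>Y - X\<close> covers \<open>Y\<close>, which has size
  \<kappa>.\<close>

lemma full_size_image:
  assumes \<kappa>: "regular_cardinal \<kappa>" and X: "X \<subseteq> Field \<kappa>"
    and fib: "\<And>\<gamma>. \<gamma> \<in> Field \<kappa> \<Longrightarrow> bounded_in \<kappa> (f -` {\<gamma>} \<inter> X)"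
    and f: "f \<in> Field \<kappa> \<rightarrow> Field \<kappa>"
    and Y: "Y \<in> full_size_subsets \<kappa>" "almost_subset \<kappa> Y X"
  shows "f ` (Y \<inter> X) \<in> full_size_subsets \<kappa>"
proof -
  have sub: "f ` (Y \<inter> X) \<subseteq> Field \<kappa>"
    using X f by auto
  have "\<not> |f ` (Y \<inter> X)| <o \<kappa>"
  proof
    assume "|f ` (Y \<inter> X)| <o \<kappa>"
    then have "|f -` (f ` (Y \<inter> X)) \<inter> X| <o \<kappa>"
      using small_vimage[OF \<kappa> X fib sub] by blast
    moreover have "|Y - X| <o \<kappa>"
      using Y almost_subset_iff_small[OF \<kappa>] by (auto simp: full_size_subsets_def)
    ultimately have "|f -` (f ` (Y \<inter> X)) \<inter> X \<union> (Y - X)| <o \<kappa>"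
      by (rule small_Un[OF \<kappa>])
    moreover have "Y \<subseteq> f -` (f ` (Y \<inter> X)) \<inter> X \<union> (Y - X)"
      by auto
    ultimately have "|Y| <o \<kappa>"
      using card_of_mono1 ordLeq_ordLess_trans by blast
    then show False
      using Y(1) full_size_iff_not_small[OF \<kappa>] by blast
  qed
  then show ?thesis
    using sub full_size_iff_not_small[OF \<kappa>] by blast
qed

lemma almost_subset_image:
  assumes \<kappa>: "regular_cardinal \<kappa>" and X: "X \<subseteq> Field \<kappa>"
    and f: "f \<in> Field \<kappa> \<rightarrow> Field \<kappa>"
    and Y: "Y \<subseteq> Field \<kappa>" "almost_subset \<kappa> Y (f -` A \<inter> X)"
  shows "almost_subset \<kappa> (f ` (Y \<inter> X)) A"
proof -
  have "|Y - f -` A \<inter> X| <o \<kappa>"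
    using Y almost_subset_iff_small[OF \<kappa>] by blast
  then have "|f ` (Y - f -` A \<inter> X)| <o \<kappa>"
    using card_of_image ordLeq_ordLess_trans by blast
  moreover have "f ` (Y \<inter> X) - A \<subseteq> f ` (Y - f -` A \<inter> X)"
    by auto
  ultimately have "|f ` (Y \<inter> X) - A| <o \<kappa>"
    using card_of_mono1 ordLeq_ordLess_trans by blast
  then show ?thesis
    using almost_subset_iff_small[OF \<kappa>, of "f ` (Y \<inter> X)"] X f by auto
qed

text \<open>Preimages commute with differences, so the error set is the preimage within
  \<open>X\<close> of the small set \<open>A - B\<close>.\<close>

lemma almost_subset_vimage:
  assumes \<kappa>: "regular_cardinal \<kappa>" and X: "X \<subseteq> Field \<kappa>"
    and fib: "\<And>\<gamma>. \<gamma> \<in> Field \<kappa> \<Longrightarrow> bounded_in \<kappa> (f -` {\<gamma>} \<inter> X)"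
    and A: "A \<subseteq> Field \<kappa>" "almost_subset \<kappa> A B"
  shows "almost_subset \<kappa> (f -` A \<inter> X) (f -` B \<inter> X)"
proof -
  have "|A - B| <o \<kappa>" "A - B \<subseteq> Field \<kappa>"
    using A almost_subset_iff_small[OF \<kappa>] by blast+
  then have "|f -` (A - B) \<inter> X| <o \<kappa>"
    using small_vimage[OF \<kappa> X fib] by blast
  moreover have "f -` (A - B) \<inter> X = f -` A \<inter> X - f -` B \<inter> X"
    by auto
  ultimately show ?thesis
    using almost_subset_iff_small[OF \<kappa>, of "f -` A \<inter> X"] X by (metis inf.coboundedI2)
qed

lemma vimage_in_sets_of:
  assumes "A \<in> sets_of S (filtermap f W)" "X \<in> sets_of S W"
  shows "f -` A \<inter> X \<in> sets_of S W"
  using assms by (auto simp: sets_of_def eventually_filtermap eventually_conj_iff)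

lemma almost_subset_Int2:
  "almost_subset \<kappa> A (B \<inter> C) \<Longrightarrow> almost_subset \<kappa> A C"
  by (auto simp: almost_subset_def)

lemma pi_base_RB_image:
  assumes \<kappa>: "regular_cardinal \<kappa>" and f: "f \<in> Field \<kappa> \<rightarrow> Field \<kappa>"
    and X: "X \<in> sets_of (Field \<kappa>) W"
    and fib: "\<And>\<gamma>. \<gamma> \<in> Field \<kappa> \<Longrightarrow> bounded_in \<kappa> (f -` {\<gamma>} \<inter> X)"
    and \<B>: "pi_base \<kappa> W \<B>"
  shows "pi_base \<kappa> (filtermap f W) ((\<lambda>B. f ` (B \<inter> X)) ` {B \<in> \<B>. almost_subset \<kappa> B X})"
  unfolding pi_base_def
proof (intro conjI ballI)
  have XF: "X \<subseteq> Field \<kappa>" using X by (simp add: sets_of_def)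
  show "(\<lambda>B. f ` (B \<inter> X)) ` {B \<in> \<B>. almost_subset \<kappa> B X} \<subseteq> full_size_subsets \<kappa>"
    using full_size_image[OF \<kappa> XF fib f] \<B> by (auto simp: pi_base_def)
  fix A assume "A \<in> sets_of (Field \<kappa>) (filtermap f W)"
  then have "f -` A \<inter> X \<in> sets_of (Field \<kappa>) W"
    using X by (rule vimage_in_sets_of)
  then obtain B where B: "B \<in> \<B>" "almost_subset \<kappa> B (f -` A \<inter> X)"
    using \<B> by (auto simp: pi_base_def)
  then have "B \<subseteq> Field \<kappa>"
    using \<B> by (auto simp: pi_base_def full_size_subsets_def)
  then have "almost_subset \<kappa> (f ` (B \<inter> X)) A"
    using almost_subset_image[OF \<kappa> XF f] B(2) by blast
  with B show "\<exists>C \<in> (\<lambda>B. f ` (B \<inter> X)) ` {B \<in> \<B>. almost_subset \<kappa> B X}. almost_subset \<kappa> C A"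
    by (auto dest: almost_subset_Int2)
qed

text \<open>The lifted tower has the same index order, so each length realised below is realised in
  \<open>W\<close>, and the minimum for \<open>W\<close> can only be smaller or equal.\<close>

lemma pi_tower_length_RB:
  assumes \<kappa>: "regular_cardinal \<kappa>" and f: "f \<in> Field \<kappa> \<rightarrow> Field \<kappa>"
    and X: "X \<in> sets_of (Field \<kappa>) W"
    and fib: "\<And>\<gamma>. \<gamma> \<in> Field \<kappa> \<Longrightarrow> bounded_in \<kappa> (f -` {\<gamma>} \<inter> X)"
    and l: "pi_tower_length \<kappa> (filtermap f W) l"
  shows "pi_tower_length \<kappa> W l"
proof -
  have XF: "X \<subseteq> Field \<kappa>" using X by (simp add: sets_of_def)
  obtain T where reg: "regular_cardinal l"
    and T: "\<forall>i \<in> Field l. T i \<in> sets_of (Field \<kappa>) (filtermap f W)"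
    and dec: "\<forall>i j. (i, j) \<in> l \<and> i \<noteq> j \<longrightarrow> almost_subset \<kappa> (T j) (T i)"
    and no: "\<not> (\<exists>Y. pseudo_intersection \<kappa> (Field l) T Y)"
    using l unfolding pi_tower_length_def by blast
  define T' where "T' i = f -` T i \<inter> X" for i
  have "\<forall>i \<in> Field l. T' i \<in> sets_of (Field \<kappa>) W"
    using T X vimage_in_sets_of unfolding T'_def by blast
  moreover have "almost_subset \<kappa> (T' j) (T' i)" if ij: "(i, j) \<in> l" "i \<noteq> j" for i j
  proof -
    have "T j \<subseteq> Field \<kappa>"
      using ij T by (auto simp: sets_of_def Field_def)
    then show ?thesis
      using almost_subset_vimage[OF \<kappa> XF fib] dec ij unfolding T'_def by blast
  qed
  moreover have "\<not> pseudo_intersection \<kappa> (Field l) T' Y" for Y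
  proof
    assume "pseudo_intersection \<kappa> (Field l) T' Y"
    then have Y: "Y \<in> full_size_subsets \<kappa>" and YT: "\<And>i. i \<in> Field l \<Longrightarrow> almost_subset \<kappa> Y (T' i)"
      by (auto simp: pseudo_intersection_def)
    have YF: "Y \<subseteq> Field \<kappa>" using Y by (simp add: full_size_subsets_def)
    \<comment> \<open>A single term of the lifted tower suffices, as each lies inside
      \<open>X\<close>; there is one because a regular cardinal is infinite.\<close>
    have "almost_subset \<kappa> Y X"
      using YT Field_nonempty_of_regular[OF reg] almost_subset_Int2 unfolding T'_def by blast
    then have "f ` (Y \<inter> X) \<in> full_size_subsets \<kappa>"
      using full_size_image[OF \<kappa> XF fib f Y] by blast
    moreover have "almost_subset \<kappa> (f ` (Y \<inter> X)) (T i)" if "i \<in> Field l" for i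
      using almost_subset_image[OF \<kappa> XF f YF] YT[OF that] unfolding T'_def by blast
    ultimately show False
      using no unfolding pseudo_intersection_def by blast
  qed
  ultimately show ?thesis
    using reg unfolding pi_tower_length_def by blast
qed

theorem theorem2p20:
  fixes \<kappa> :: "'a rel" and U W :: "'a filter"
  assumes "regular_uncountable_cardinal \<kappa>"
    and "uniform_ultrafilter \<kappa> U" and "uniform_ultrafilter \<kappa> W"
    and "RB_le \<kappa> U W"
  shows "pi_t \<kappa> W \<le>o\<infinity> pi_t \<kappa> U \<and> pi_ch \<kappa> U \<le>o pi_ch \<kappa> W"
proof
  have \<kappa>: "regular_cardinal \<kappa>"
    using assms(1) by (simp add: regular_uncountable_cardinal_def)
  obtain f X where f: "f \<in> Field \<kappa> \<rightarrow> Field \<kappa>" and U: "filtermap f W = U"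
    and X: "X \<in> sets_of (Field \<kappa>) W"
    and fib: "\<And>\<gamma>. \<gamma> \<in> Field \<kappa> \<Longrightarrow> bounded_in \<kappa> (f -` {\<gamma>} \<inter> X)"
    using assms(4) unfolding RB_le_def almost_one_to_one_def by blast
  show "pi_t \<kappa> W \<le>o\<infinity> pi_t \<kappa> U"
  proof (cases "\<exists>l :: 'a set rel. pi_tower_length \<kappa> U l")
    case True
    then obtain l where l: "pi_t \<kappa> U = Some l" "pi_tower_length \<kappa> U l"
      using pi_t_least[OF \<kappa> assms(2)] by blast
    then have "pi_tower_length \<kappa> W l"
      using pi_tower_length_RB[OF \<kappa> f X fib] U by blast
    then obtain m where "pi_t \<kappa> W = Some m" "m \<le>o l"
      using pi_t_least[OF \<kappa> assms(3)] by blast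
    with l(1) show ?thesis by simp
  next
    case False
    \<comment> \<open>With no tower for \<open>U\<close>, the right-hand side is
      \<open>None\<close>, which stands for infinity and bounds everything.\<close>
    then show ?thesis by (simp add: pi_t_eq_None_iff[THEN iffD2])
  qed
  \<comment> \<open>A \<pi>-base of least size for \<open>W\<close>. Its transfer to
    \<open>U\<close> is an image of a subfamily, so it has at most that size.\<close>
  obtain \<B> where \<B>: "pi_base \<kappa> W \<B>" "pi_ch \<kappa> W = |\<B>|"
    using pi_ch_least(1)[OF \<kappa> assms(3)] by blast
  define \<C> where "\<C> = (\<lambda>B. f ` (B \<inter> X)) ` {B \<in> \<B>. almost_subset \<kappa> B X}"
  have "pi_base \<kappa> U \<C>"
    using pi_base_RB_image[OF \<kappa> f X fib \<B>(1)] U by (simp add: \<C>_def)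
  then have "pi_ch \<kappa> U \<le>o |\<C>|"
    by (rule pi_ch_least(2)[OF \<kappa> assms(2)])
  also have "|\<C>| \<le>o |{B \<in> \<B>. almost_subset \<kappa> B X}|"
    unfolding \<C>_def by (rule card_of_image)
  also have "|{B \<in> \<B>. almost_subset \<kappa> B X}| \<le>o |\<B>|"
    by (rule card_of_mono1) auto
  finally show "pi_ch \<kappa> U \<le>o pi_ch \<kappa> W"
    using \<B>(2) by simp
qed

end
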